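(* Let $q$ be a prime power and $n,r\ge 1$ integers, and let $f=(f_1,\ldots,f_r)$ and $g=(g_1,\ldots,g_r)$ be $r$-tuples of $\mathbb{F}_q$-endomorphisms of $\mathbb{F}_{q^n}$ such that $(\mathcal{D}_{r,n,q},U_f,W_g)$ is a BEL-configuration in $V(rn,q)$. Then the semifield spread $\mathcal{S}(\mathcal{D}_{r,n,q},U_f,W_g)$ is equivalent to $\mathcal{S}(\mathbb{S}_{f,g})$, where $\mathbb{S}_{f,g}$ is the (pre)semifield with elements $\mathbb{F}_{q^n}$, the usual addition, and multiplication $$\mathbb{S}_{f,g}(x,y)=\sum_{i=1}^r g_i(f_i(x)y).$$
   Context: $V(m,q)$ denotes an $m$-dimensional vector space over $\mathbb{F}_q$. Represent $V(rn,q)$ as $(\mathbb{F}_{q^n})^r$, regarded as an $\mathbb{F}_q$-space. For a nonzero vector $v=(v_1,\ldots,v_r)$ put $\mathcal{B}(v)=\{(\alpha v_1,\ldots,\alpha v_r):\alpha\in\mathbb{F}_{q^n}\}$ and $\mathcal{D}_{r,n,q}=\{\mathcal{B}(v): v\neq 0\}$; this is a Desarguesian $n$-spread. For a subset $A$, $\mathcal{B}(A)=\{S\in\mathcal{D}_{r,n,q}: S\cap A\not\subseteq\{0\}\}$ is the set of spread elements containing a nonzero vector of $A$. A BEL-configuration $(\mathcal{D}_{r,n,q},U,W)$ in $V(rn,q)$ consists of $\mathcal{D}_{r,n,q}$ and $\mathbb{F}_q$-subspaces $U$ of dimension $n$ and $W$ of dimension $rn-n$ with $\mathcal{B}(U)\cap\mathcal{B}(W)=\emptyset$.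 The spread $\mathcal{S}(\mathcal{D}_{r,n,q},U,W)$: embed $V(rn,q)$ in $V(rn+n,q)=\{(v_0,v_1,\ldots,v_r):v_i\in\mathbb{F}_{q^n}\}$ as the subspace $v_0=0$, let $\mathcal{B}(z)$ denote the element of $\mathcal{D}_{r+1,n,q}$ containing $z\ne0$, and choose $v\in V(rn+n,q)\setminus V(rn,q)$. Then $$\mathcal{S}(\mathcal{D}_{r,n,q},U,W)=\left\{\frac{\langle\mathcal{B}(z),W\rangle}{W}: 0\ne z\in\langle v,U\rangle\right\},$$ which is known to be a semifield spread in $V(rn+n,q)/W\cong V(2n,q)$. For $r$-tuples $f,g$ of $\mathbb{F}_q$-endomorphisms of $\mathbb{F}_{q^n}$: $U_f=\{(f_1(x),\ldots,f_r(x)):x\in\mathbb{F}_{q^n}\}$ and $W_g=\{(x_1,\ldots,x_r)\in(\mathbb{F}_{q^n})^r:\sum_{i=1}^r g_i(x_i)=0\}$. A presemifield is a finite (not necessarily associative) algebra in which both distributive laws hold and there are no zero divisors; a semifield is a presemifield with a multiplicative identity. For a presemifield $\mathbb{S}$ on $\mathbb{F}_{q^n}$ with $\mathbb{F}_q$-bilinear multiplication $\mathbb{S}(x,y)$, the associated spread of $V(2n,q)=(\mathbb{F}_{q^n})^2$ is $\mathcal{S}(\mathbb{S})=\{A_y:y\in\mathbb{F}_{q^n}\}\cup\{A_\infty\}$, with $A_y=\{(x,\mathbb{S}(x,y)):x\in\mathbb{F}_{q^n}\}$ and $A_\infty=\{(0,x):x\in\mathbb{F}_{q^n}\}$. Two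 $n$-spreads of $2n$-dimensional $\mathbb{F}_q$-spaces are equivalent if a bijective $\mathbb{F}_q$-semilinear map takes one to the other.
   Formalization: The spread of S_{f,g} is taken with components {(y, S(x,y)) : y} for each fixed x, plus A_∞, instead of {(x, S(x,y)) : x} for each fixed y; with the latter the claim fails, e.g. for S(x,y)=xy+dx^9y^3 over F_81, d a nonsquare. *)

theory Defs
  imports Complex_Main "HOL-Library.Cardinality" "HOL-Library.Function_Algebras" "HOL-Library.Product_Plus"
begin

text \<open>
  The field with \<open>q\<close> elements is a finite field type \<open>'k\<close>, the field with \<open>q ^ n\<close> elements is a
  finite field type \<open>'a\<close>, and the inclusion of the former into the latter is an explicit ring
  homomorphism \<open>\<iota>\<close>, so that the locale \<open>vector_space\<close> and its notions \<open>subspace\<close>, \<open>span\<close>, \<open>dim\<close>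
  apply to the scalar multiplications below.
\<close>

definition field_hom :: "('k::field \<Rightarrow> 'a::field) \<Rightarrow> bool" where
  "field_hom h \<longleftrightarrow>
     (\<forall>a b. h (a + b) = h a + h b) \<and> (\<forall>a b. h (a * b) = h a * h b) \<and> h 1 = 1"

definition scale :: "('k::field \<Rightarrow> 'a::field) \<Rightarrow> 'k \<Rightarrow> 'a \<Rightarrow> 'a" where
  "scale \<iota> c x = \<iota> c * x"

definition scale_vec :: "('k::field \<Rightarrow> 'a::field) \<Rightarrow> 'k \<Rightarrow> (nat \<Rightarrow> 'a) \<Rightarrow> (nat \<Rightarrow> 'a)" where
  "scale_vec \<iota> c v = (\<lambda>i. \<iota> c * v i)"

definition scale_pair :: "('k::field \<Rightarrow> 'a::field) \<Rightarrow> 'k \<Rightarrow> 'a \<times> 'a \<Rightarrow> 'a \<times> 'a" where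
  "scale_pair \<iota> c p = (\<iota> c * fst p, \<iota> c * snd p)"

lemma vector_space_scale: "field_hom \<iota> \<Longrightarrow> vector_space (scale \<iota>)"
  by unfold_locales (auto simp: scale_def field_hom_def algebra_simps)

lemma vector_space_scale_vec: "field_hom \<iota> \<Longrightarrow> vector_space (scale_vec \<iota>)"
  by unfold_locales (auto simp: scale_vec_def field_hom_def algebra_simps)

lemma vector_space_scale_pair: "field_hom \<iota> \<Longrightarrow> vector_space (scale_pair \<iota>)"
  by unfold_locales (auto simp: scale_pair_def field_hom_def algebra_simps prod_eq_iff)

text \<open>
  Coordinate vectors are functions on \<open>nat\<close> vanishing outside the index set: \<open>V(rn,q)\<close> is
  \<open>coord_space {1..r}\<close> and \<open>V(rn+n,q)\<close> is \<open>coord_space {0..r}\<close>, so the embedding of the former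
  as \<open>v\<^sub>0 = 0\<close> is plain inclusion.
\<close>

definition coord_space :: "nat set \<Rightarrow> (nat \<Rightarrow> 'a::zero) set" where
  "coord_space I = {v. \<forall>i. i \<notin> I \<longrightarrow> v i = 0}"

definition line :: "(nat \<Rightarrow> 'a::field) \<Rightarrow> (nat \<Rightarrow> 'a) set" where
  "line v = {(\<lambda>i. \<alpha> * v i) | \<alpha>. True}"

definition desarguesian_spread :: "nat \<Rightarrow> (nat \<Rightarrow> 'a::field) set set" where
  "desarguesian_spread r = {line v | v. v \<in> coord_space {1..r} \<and> v \<noteq> 0}"

definition lines_meeting :: "nat \<Rightarrow> (nat \<Rightarrow> 'a::field) set \<Rightarrow> (nat \<Rightarrow> 'a) set set" where
  "lines_meeting r A = {S \<in> desarguesian_spread r. \<not> S \<inter> A \<subseteq> {0}}"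

definition BEL_configuration ::
  "('k::field \<Rightarrow> 'a::field) \<Rightarrow> nat \<Rightarrow> nat \<Rightarrow> (nat \<Rightarrow> 'a) set \<Rightarrow> (nat \<Rightarrow> 'a) set \<Rightarrow> bool" where
  "BEL_configuration \<iota> r n U W \<longleftrightarrow>
     U \<subseteq> coord_space {1..r} \<and> module.subspace (scale_vec \<iota>) U \<and>
     vector_space.dim (scale_vec \<iota>) U = n \<and>
     W \<subseteq> coord_space {1..r} \<and> module.subspace (scale_vec \<iota>) W \<and>
     vector_space.dim (scale_vec \<iota>) W = r * n - n \<and>
     lines_meeting r U \<inter> lines_meeting r W = {}"

definition coset :: "'v::ab_group_add set \<Rightarrow> 'v \<Rightarrow> 'v set" where
  "coset W x = {x + w | w. w \<in> W}"

definition quotient_set :: "'v::ab_group_add set \<Rightarrow> 'v set \<Rightarrow> 'v set set" where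
  "quotient_set A W = coset W ` A"

text \<open>\<open>line z\<close> below ranges over the Desarguesian spread of the larger space, as \<open>z\<close> may have a
  nonzero entry at index 0.\<close>

definition BEL_spread ::
  "('k::field \<Rightarrow> 'a::field) \<Rightarrow> (nat \<Rightarrow> 'a) set \<Rightarrow> (nat \<Rightarrow> 'a) set \<Rightarrow> (nat \<Rightarrow> 'a)
     \<Rightarrow> (nat \<Rightarrow> 'a) set set set" where
  "BEL_spread \<iota> U W v =
     {quotient_set (module.span (scale_vec \<iota>) (line z \<union> W)) W | z.
        z \<in> module.span (scale_vec \<iota>) (insert v U) \<and> z \<noteq> 0}"

record ('k, 'v) vspace =
  vcarrier :: "'v set"
  vadd :: "'v \<Rightarrow> 'v \<Rightarrow> 'v"
  vscale :: "'k \<Rightarrow> 'v \<Rightarrow> 'v"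

text \<open>In the quotient, \<open>c (x + W) + W = c x + W\<close> also for \<open>c = 0\<close>, where the pointwise multiple
  of a coset would be \<open>{0}\<close>.\<close>

definition quotient_vspace ::
  "('k \<Rightarrow> 'v \<Rightarrow> 'v) \<Rightarrow> 'v::ab_group_add set \<Rightarrow> 'v set \<Rightarrow> ('k, 'v set) vspace" where
  "quotient_vspace s V W =
     \<lparr> vcarrier = quotient_set V W,
       vadd = (\<lambda>A B. {a + b | a b. a \<in> A \<and> b \<in> B}),
       vscale = (\<lambda>c A. {s c a + w | a w. a \<in> A \<and> w \<in> W}) \<rparr>"

definition plane_vspace :: "('k::field \<Rightarrow> 'a::field) \<Rightarrow> ('k, 'a \<times> 'a) vspace" where
  "plane_vspace \<iota> = \<lparr> vcarrier = UNIV, vadd = (+), vscale = scale_pair \<iota> \<rparr>"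

definition semilinear_bijection ::
  "('k::field, 'v) vspace \<Rightarrow> ('k, 'w) vspace \<Rightarrow> ('v \<Rightarrow> 'w) \<Rightarrow> bool" where
  "semilinear_bijection X Y \<phi> \<longleftrightarrow>
     bij_betw \<phi> (vcarrier X) (vcarrier Y) \<and>
     (\<forall>x\<in>vcarrier X. \<forall>y\<in>vcarrier X. \<phi> (vadd X x y) = vadd Y (\<phi> x) (\<phi> y)) \<and>
     (\<exists>\<sigma>. field_hom \<sigma> \<and> bij \<sigma> \<and>
        (\<forall>c. \<forall>x\<in>vcarrier X. \<phi> (vscale X c x) = vscale Y (\<sigma> c) (\<phi> x)))"

definition equivalent_spreads ::
  "('k::field, 'v) vspace \<Rightarrow> 'v set set \<Rightarrow> ('k, 'w) vspace \<Rightarrow> 'w set set \<Rightarrow> bool" where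
  "equivalent_spreads X \<S> Y \<T> \<longleftrightarrow>
     (\<exists>\<phi>. semilinear_bijection X Y \<phi> \<and> (\<lambda>S. \<phi> ` S) ` \<S> = \<T>)"

definition U_space :: "nat \<Rightarrow> (nat \<Rightarrow> 'a \<Rightarrow> 'a::field) \<Rightarrow> (nat \<Rightarrow> 'a) set" where
  "U_space r f = {(\<lambda>i. if i \<in> {1..r} then f i x else 0) | x. True}"

definition W_space :: "nat \<Rightarrow> (nat \<Rightarrow> 'a \<Rightarrow> 'a::field) \<Rightarrow> (nat \<Rightarrow> 'a) set" where
  "W_space r g = {x \<in> coord_space {1..r}. (\<Sum>i=1..r. g i (x i)) = 0}"

text \<open>Finiteness is carried by the type.\<close>

definition presemifield :: "('a::{field,finite} \<Rightarrow> 'a \<Rightarrow> 'a) \<Rightarrow> bool" where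
  "presemifield m \<longleftrightarrow>
     (\<forall>x y z. m (x + y) z = m x z + m y z) \<and> (\<forall>x y z. m x (y + z) = m x y + m x z) \<and>
     (\<forall>x y. m x y = 0 \<longrightarrow> x = 0 \<or> y = 0)"

text \<open>
  The spread of a presemifield is made of the graphs of the left multiplications
  \<open>y \<mapsto> m x y\<close>, one for each first factor \<open>x\<close>, together with \<open>{0} \<times> 'a\<close>. Pitfall: a common
  alternative uses the graphs of the right multiplications \<open>x \<mapsto> m x y\<close>; it gives the spread of
  the opposite presemifield, which is in general not equivalent to this one. The spread
  \<open>BEL_spread\<close> of \<open>U_space r f\<close>, \<open>W_space r g\<close> matches \<open>BEL_mult r f g\<close> only with left
  multiplications, because the line through \<open>(1, f\<^sub>1 x, \<dots>, f\<^sub>r x)\<close> maps to the graph of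
  \<open>y \<mapsto> BEL_mult r f g x y\<close> modulo \<open>W_space r g\<close>.
\<close>

definition presemifield_spread :: "('a::field \<Rightarrow> 'a \<Rightarrow> 'a) \<Rightarrow> ('a \<times> 'a) set set" where
  "presemifield_spread m = {{(y, m x y) | y. True} | x. True} \<union> {{(0, y) | y. True}}"

definition BEL_mult ::
  "nat \<Rightarrow> (nat \<Rightarrow> 'a \<Rightarrow> 'a) \<Rightarrow> (nat \<Rightarrow> 'a \<Rightarrow> 'a) \<Rightarrow> 'a::field \<Rightarrow> 'a \<Rightarrow> 'a" where
  "BEL_mult r f g x y = (\<Sum>i=1..r. g i (f i x * y))"

end

theory Submission
  imports Defs "HOL-Library.FuncSet"
begin

text \<open>
  Write \<open>F x = (f\<^sub>1 x, \<dots>, f\<^sub>r x)\<close> and \<open>G a = g\<^sub>1 a\<^sub>1 + \<dots> + g\<^sub>r a\<^sub>r\<close>, so that \<open>U\<close> is the image of \<open>F\<close>,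
  \<open>W\<close> is the kernel of \<open>G\<close> and the product of \<open>x\<close> and \<open>y\<close> is \<open>G (y F x)\<close>. The vectors \<open>F x\<close> and
  \<open>y F x\<close> lie on a common spread element, so if the product vanishes for nonzero \<open>x\<close> and \<open>y\<close>, that
  element meets both \<open>U\<close> and \<open>W\<close> outside \<open>0\<close>, unless \<open>F x = 0\<close>. The latter is excluded because
  \<open>U\<close> has dimension \<open>n\<close>, whence \<open>F\<close> is injective (\<open>tuple_inj\<close>). This gives the presemifield
  (\<open>presemifield_BEL_mult\<close>); in particular every nonzero \<open>x\<close> has a surjective left
  multiplication, so that \<open>G\<close> is surjective.

  For the equivalence, let \<open>a'\<close> denote the coordinates \<open>1, \<dots>, r\<close> of \<open>a\<close> and consider the linear map
  \<open>\<psi> a = (a\<^sub>0 / v\<^sub>0, G (a' - (a\<^sub>0 / v\<^sub>0) v'))\<close> (\<open>plane_coords\<close>), which is \<open>a \<mapsto> (a\<^sub>0, G a')\<close> preceded by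
  the shear moving \<open>v\<close> to \<open>(1, 0, \<dots>, 0)\<close>. The shear is linear over the large field and fixes the
  hyperplane \<open>a\<^sub>0 = 0\<close> pointwise, which is why the choice of \<open>v\<close> does not matter. The map \<open>\<psi>\<close> is
  onto with kernel \<open>W\<close>, so it induces an isomorphism of the quotient with the plane. Being
  linear and killing \<open>W\<close>, it maps \<open>\<langle>line z, W\<rangle>\<close> onto \<open>\<psi> (line z)\<close>. Up to a scalar from the small
  field, \<open>z\<close> is either \<open>v + F x\<close>, whose line goes to the graph of the left multiplication
  by \<open>x\<close>, or \<open>F x\<close> with \<open>x \<noteq> 0\<close>, whose line goes to \<open>{0} \<times> \<bbbF>\<close> by surjectivity of that
  multiplication.
\<close>

section \<open>Linear maps and quotients\<close>

text \<open>Linear combinations of a basis with different coefficients are different, and there are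
  \<open>CARD('k) ^ dim U\<close> families of coefficients.\<close>

lemma (in vector_space) card_field_power_dim_le:
  assumes "finite (UNIV :: 'a set)" "subspace U" "finite U"
  shows "CARD('a) ^ dim U \<le> card U"
proof -
  obtain B where B: "B \<subseteq> U" "independent B" "U \<subseteq> span B" "card B = dim U"
    using basis_exists by blast
  have fB: "finite B" using B assms finite_subset by blast
  let ?comb = "\<lambda>c. \<Sum>b\<in>B. c b *s b"
  have "inj_on ?comb (PiE B (\<lambda>_. UNIV))"
  proof (rule inj_onI)
    fix c d assume c: "c \<in> PiE B (\<lambda>_. UNIV)" and d: "d \<in> PiE B (\<lambda>_. UNIV)" and eq: "?comb c = ?comb d"
    have "(\<Sum>b\<in>B. (c b - d b) *s b) = 0"
      using eq by (simp add: scale_left_diff_distrib sum_subtractf)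
    then have "c b - d b = 0" if "b \<in> B" for b
      using independentD[OF B(2) fB subset_refl, of "\<lambda>b. c b - d b"] that by blast
    then show "c = d" using c d by (intro PiE_ext) auto
  qed
  moreover have "?comb ` PiE B (\<lambda>_. UNIV) \<subseteq> U"
    using B(1) assms(2) by (auto intro!: subspace_sum subspace_scale)
  ultimately have "card (PiE B (\<lambda>_. UNIV :: 'a set)) \<le> card U"
    using card_inj_on_le assms(3) by blast
  then show ?thesis using B(4) fB by (simp add: card_PiE)
qed

lemma coset_eq_iff:
  fixes x y :: "'v::ab_group_add"
  assumes "module s" "module.subspace s W"
  shows "coset W x = coset W y \<longleftrightarrow> x - y \<in> W"
proof -
  interpret module s by fact
  note W = assms(2)
  have mem: "b \<in> coset W a \<longleftrightarrow> b - a \<in> W" for a b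
    by (auto simp: coset_def intro: exI[of _ "b - a"])
  show ?thesis
  proof
    assume "coset W x = coset W y"
    then show "x - y \<in> W" using mem subspace_0[OF W] by (metis diff_self)
  next
    assume xy: "x - y \<in> W"
    have "b - x \<in> W \<longleftrightarrow> b - y \<in> W" for b
      using subspace_add[OF W _ xy, of "b - x"] subspace_diff[OF W _ xy, of "b - y"] by auto
    then show "coset W x = coset W y" by (simp add: set_eq_iff mem)
  qed
qed

lemma quotient_vadd_coset:
  fixes W :: "'v::ab_group_add set"
  assumes "module s" "module.subspace s W"
  shows "vadd (quotient_vspace s V W) (coset W x) (coset W y) = coset W (x + y)"
proof -
  interpret module s by fact
  note W = assms(2)
  show ?thesis
  proof (intro equalityI subsetI)
    fix b assume "b \<in> vadd (quotient_vspace s V W) (coset W x) (coset W y)"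
    then obtain w w' where "w \<in> W" "w' \<in> W" "b = (x + w) + (y + w')"
      by (auto simp: quotient_vspace_def coset_def)
    then have "b = (x + y) + (w + w')" "w + w' \<in> W"
      using subspace_add[OF W] by (simp_all add: algebra_simps)
    then show "b \<in> coset W (x + y)" unfolding coset_def by blast
  next
    fix b assume "b \<in> coset W (x + y)"
    then obtain w where "w \<in> W" "b = (x + 0) + (y + w)"
      by (auto simp: coset_def add.assoc)
    then show "b \<in> vadd (quotient_vspace s V W) (coset W x) (coset W y)"
      using subspace_0[OF W] unfolding quotient_vspace_def coset_def vspace.simps by blast
  qed
qed

lemma quotient_vscale_coset:
  fixes W :: "'v::ab_group_add set"
  assumes "module s" "module.subspace s W"
  shows "vscale (quotient_vspace s V W) c (coset W x) = coset W (s c x)"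
proof -
  interpret module s by fact
  note W = assms(2)
  show ?thesis
  proof (intro equalityI subsetI)
    fix b assume "b \<in> vscale (quotient_vspace s V W) c (coset W x)"
    then obtain w w' where "w \<in> W" "w' \<in> W" "b = s c (x + w) + w'"
      by (auto simp: quotient_vspace_def coset_def)
    then have "b = s c x + (s c w + w')" "s c w + w' \<in> W"
      using subspace_add[OF W] subspace_scale[OF W] by (simp_all add: scale_right_distrib add.assoc)
    then show "b \<in> coset W (s c x)" unfolding coset_def by blast
  next
    fix b assume "b \<in> coset W (s c x)"
    then obtain w where "w \<in> W" "b = s c (x + 0) + w" by (auto simp: coset_def)
    then show "b \<in> vscale (quotient_vspace s V W) c (coset W x)"
      using subspace_0[OF W] unfolding quotient_vspace_def coset_def vspace.simps by blast
  qed
qed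

text \<open>The first isomorphism theorem. The rule for \<open>\<phi>\<close> on cosets holds also outside \<open>V\<close>, since
  \<open>\<psi>\<close> is defined there and kills \<open>W\<close>.\<close>

lemma semilinear_bijection_quotient:
  fixes s :: "'k::field \<Rightarrow> 'v::ab_group_add \<Rightarrow> 'v" and t :: "'k \<Rightarrow> 'w::ab_group_add \<Rightarrow> 'w"
  assumes lin: "Vector_Spaces.linear s t \<psi>"
    and V: "module.subspace s V" and W: "module.subspace s W"
    and ker: "{a \<in> V. \<psi> a = 0} = W" and onto: "\<psi> ` V = UNIV"
  obtains \<phi> where
    "semilinear_bijection (quotient_vspace s V W) \<lparr>vcarrier = UNIV, vadd = (+), vscale = t\<rparr> \<phi>"
    "\<And>a. \<phi> (coset W a) = \<psi> a"
proof
  interpret Vector_Spaces.linear s t \<psi> by fact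
  have m: "module s" by unfold_locales
  define \<phi> where "\<phi> C = \<psi> (SOME a. C = coset W a)" for C
  show \<phi>: "\<phi> (coset W a) = \<psi> a" for a
  proof -
    have "coset W a = coset W (SOME b. coset W a = coset W b)"
      by (rule someI) simp
    then have "a - (SOME b. coset W a = coset W b) \<in> W"
      using coset_eq_iff[OF m W] by blast
    then have "\<psi> (a - (SOME b. coset W a = coset W b)) = 0" using ker by blast
    then show ?thesis by (simp add: \<phi>_def diff)
  qed
  let ?Q = "quotient_vspace s V W"
  have Q: "vcarrier ?Q = coset W ` V" by (simp add: quotient_vspace_def quotient_set_def)
  have "inj_on \<phi> (coset W ` V)"
  proof (rule inj_onI, clarify)
    fix a b assume a: "a \<in> V" and b: "b \<in> V" and "\<phi> (coset W a) = \<phi> (coset W b)"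
    then have "\<psi> (a - b) = 0" by (simp add: \<phi> diff)
    then have "a - b \<in> W" using ker a b vs1.subspace_diff[OF V] by blast
    then show "coset W a = coset W b" using coset_eq_iff[OF m W] by blast
  qed
  moreover have "\<phi> ` coset W ` V = UNIV" using onto by (simp add: image_image \<phi>)
  ultimately have "bij_betw \<phi> (vcarrier ?Q) UNIV" by (simp add: Q bij_betw_def)
  moreover have "field_hom (id :: 'k \<Rightarrow> 'k)" by (simp add: field_hom_def)
  ultimately show "semilinear_bijection ?Q \<lparr>vcarrier = UNIV, vadd = (+), vscale = t\<rparr> \<phi>"
    unfolding semilinear_bijection_def
    by (auto simp: Q \<phi> quotient_vadd_coset[OF m W] quotient_vscale_coset[OF m W] add scale
        intro!: exI[of _ id])
qed

section \<open>The presemifield\<close>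

definition tuple :: "nat \<Rightarrow> (nat \<Rightarrow> 'a \<Rightarrow> 'a::field) \<Rightarrow> 'a \<Rightarrow> nat \<Rightarrow> 'a" where
  "tuple r f x i = (if i \<in> {1..r} then f i x else 0)"

lemma linear_scale_iff:
  assumes "field_hom \<iota>"
  shows "Vector_Spaces.linear (scale \<iota>) (scale \<iota>) h \<longleftrightarrow>
    (\<forall>x y. h (x + y) = h x + h y) \<and> (\<forall>c x. h (\<iota> c * x) = \<iota> c * h x)"
  using vector_space_scale[OF assms]
  by (auto simp: Vector_Spaces.linear_def module_hom_def module_hom_axioms_def scale_def
      vector_space_def module_def)

locale BEL_data =
  fixes \<iota> :: "'k::{field,finite} \<Rightarrow> 'a::{field,finite}"
    and n r :: nat
    and f g :: "nat \<Rightarrow> 'a \<Rightarrow> 'a"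
  assumes hom: "field_hom \<iota>"
    and card_eq: "CARD('a) = CARD('k) ^ n"
    and f_linear: "i \<in> {1..r} \<Longrightarrow> Vector_Spaces.linear (scale \<iota>) (scale \<iota>) (f i)"
    and g_linear: "i \<in> {1..r} \<Longrightarrow> Vector_Spaces.linear (scale \<iota>) (scale \<iota>) (g i)"
    and BEL: "BEL_configuration \<iota> r n (U_space r f) (W_space r g)"
begin

sublocale vec: vector_space "scale_vec \<iota>"
  by (rule vector_space_scale_vec[OF hom])

sublocale pair: vector_space "scale_pair \<iota>"
  by (rule vector_space_scale_pair[OF hom])

lemma f_add: "i \<in> {1..r} \<Longrightarrow> f i (x + y) = f i x + f i y"
  and f_scale: "i \<in> {1..r} \<Longrightarrow> f i (\<iota> c * x) = \<iota> c * f i x"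
  and g_add: "i \<in> {1..r} \<Longrightarrow> g i (x + y) = g i x + g i y"
  and g_scale: "i \<in> {1..r} \<Longrightarrow> g i (\<iota> c * x) = \<iota> c * g i x"
  using f_linear g_linear by (simp_all add: linear_scale_iff[OF hom])

lemma \<iota>_0: "\<iota> 0 = 0"
  using hom by (metis field_hom_def add_cancel_left_left add_0)

lemma f_0: "i \<in> {1..r} \<Longrightarrow> f i 0 = 0"
  using f_scale[of i 0 0] \<iota>_0 by simp

lemma U_space_eq: "U_space r f = range (tuple r f)"
  by (auto simp: U_space_def tuple_def[abs_def])

text \<open>The image \<open>U\<close> has dimension \<open>n\<close>, hence at least as many elements as the domain.\<close>

lemma tuple_inj: "inj (tuple r f)"
proof (rule eq_card_imp_inj_on)
  have "vec.subspace (U_space r f)" "vec.dim (U_space r f) = n"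
    using BEL by (auto simp: BEL_configuration_def)
  then have "CARD('a) \<le> card (range (tuple r f))"
    using vec.card_field_power_dim_le[of "U_space r f"] card_eq by (simp add: U_space_eq)
  moreover have "card (range (tuple r f)) \<le> CARD('a)" by (simp add: card_image_le)
  ultimately show "card (range (tuple r f)) = CARD('a)" by simp
qed simp

lemma tuple_eq_0_iff: "tuple r f x = 0 \<longleftrightarrow> x = 0"
proof
  assume "tuple r f x = 0"
  then have "tuple r f x = tuple r f 0" by (auto simp: fun_eq_iff tuple_def f_0)
  then show "x = 0" using tuple_inj by (simp add: inj_eq)
qed (auto simp: fun_eq_iff tuple_def f_0)

text \<open>A zero divisor would put \<open>F x \<in> U\<close> and \<open>y F x \<in> W\<close> on the same spread element.\<close>

lemma presemifield_BEL_mult: "presemifield (BEL_mult r f g)"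
  unfolding presemifield_def
proof (intro conjI allI impI)
  fix x y z
  show "BEL_mult r f g (x + y) z = BEL_mult r f g x z + BEL_mult r f g y z"
    by (simp add: BEL_mult_def f_add g_add distrib_right sum.distrib)
  show "BEL_mult r f g x (y + z) = BEL_mult r f g x y + BEL_mult r f g x z"
    by (simp add: BEL_mult_def g_add distrib_left sum.distrib)
next
  fix x y
  assume 0: "BEL_mult r f g x y = 0"
  show "x = 0 \<or> y = 0"
  proof (rule ccontr)
    assume "\<not> (x = 0 \<or> y = 0)"
    then have x: "x \<noteq> 0" and y: "y \<noteq> 0" by auto
    let ?u = "tuple r f x" and ?w = "\<lambda>i. y * tuple r f x i"
    have u: "?u \<noteq> 0" using x by (simp add: tuple_eq_0_iff)
    have w: "?w \<noteq> 0" using u y by (auto simp: fun_eq_iff)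
    have D: "line ?u \<in> desarguesian_spread r"
      using u unfolding desarguesian_spread_def coord_space_def by (auto simp: tuple_def)
    have "?u \<in> line ?u" unfolding line_def by (auto intro!: exI[of _ 1])
    moreover have "?u \<in> U_space r f" by (simp add: U_space_eq)
    ultimately have "line ?u \<in> lines_meeting r (U_space r f)"
      using D u unfolding lines_meeting_def by blast
    moreover have "?w \<in> line ?u" unfolding line_def by blast
    moreover have "?w \<in> W_space r g"
      using 0 by (simp add: W_space_def coord_space_def BEL_mult_def tuple_def mult.commute)
    ultimately have "line ?u \<in> lines_meeting r (U_space r f) \<inter> lines_meeting r (W_space r g)"
      using D w unfolding lines_meeting_def by blast
    then show False using BEL by (auto simp: BEL_configuration_def)
  qed
qed

lemma surj_BEL_mult:
  assumes "x \<noteq> 0"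
  shows "surj (BEL_mult r f g x)"
proof (rule finite_UNIV_inj_surj)
  interpret additive "BEL_mult r f g x"
    using presemifield_BEL_mult by unfold_locales (simp add: presemifield_def)
  show "inj (BEL_mult r f g x)"
  proof (rule injI)
    fix y z assume "BEL_mult r f g x y = BEL_mult r f g x z"
    then have "BEL_mult r f g x (y - z) = 0" by (simp add: diff)
    then have "y - z = 0" using presemifield_BEL_mult assms unfolding presemifield_def by blast
    then show "y = z" by simp
  qed
qed simp

section \<open>The equivalence of the spreads\<close>

text \<open>This is \<open>a \<mapsto> (a\<^sub>0, G a')\<close> after the shear that moves \<open>v\<close> to \<open>(1, 0, \<dots>, 0)\<close>.\<close>

definition plane_coords :: "(nat \<Rightarrow> 'a) \<Rightarrow> (nat \<Rightarrow> 'a) \<Rightarrow> 'a \<times> 'a" where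
  "plane_coords v a = (a 0 / v 0, \<Sum>i=1..r. g i (a i - a 0 / v 0 * v i))"

lemma linear_plane_coords:
  "Vector_Spaces.linear (scale_vec \<iota>) (scale_pair \<iota>) (plane_coords v)"
proof unfold_locales
  fix a b :: "nat \<Rightarrow> 'a" and c
  have "g i ((a + b) i - (a + b) 0 / v 0 * v i)
      = g i (a i - a 0 / v 0 * v i) + g i (b i - b 0 / v 0 * v i)" if "i \<in> {1..r}" for i
    by (subst g_add[OF that, symmetric]) (simp add: add_divide_distrib algebra_simps)
  then show "plane_coords v (a + b) = plane_coords v a + plane_coords v b"
    by (simp add: plane_coords_def add_divide_distrib sum.distrib)
  have "g i (\<iota> c * a i - \<iota> c * a 0 / v 0 * v i) = \<iota> c * g i (a i - a 0 / v 0 * v i)"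
    if "i \<in> {1..r}" for i
    by (subst g_scale[OF that, symmetric]) (simp add: algebra_simps)
  then show "plane_coords v (scale_vec \<iota> c a) = scale_pair \<iota> c (plane_coords v a)"
    by (simp add: plane_coords_def scale_vec_def scale_pair_def sum_distrib_left)
qed

lemma coord_space_hyperplane: "coord_space {1..r} = {a \<in> coord_space {0..r}. a 0 = 0}"
proof -
  have "i \<notin> {1..r} \<longleftrightarrow> i \<notin> {0..r} \<or> i = 0" for i by auto
  then show ?thesis unfolding coord_space_def by blast
qed

text \<open>Values of \<open>plane_coords\<close> on the lines through the vectors of \<open>\<langle>v, U\<rangle>\<close>; the case \<open>c = 0\<close> is
  the one of the lines through \<open>U\<close>.\<close>

lemma plane_coords_line:
  assumes "v 0 \<noteq> 0" "\<And>i. i \<in> {1..r} \<Longrightarrow> z i = c * v i + f i x" "z 0 = c * v 0"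
  shows "plane_coords v (\<lambda>i. \<alpha> * z i) = (\<alpha> * c, BEL_mult r f g x \<alpha>)"
  using assms by (auto simp: plane_coords_def BEL_mult_def algebra_simps intro!: sum.cong)

text \<open>Onto: given \<open>(y, b)\<close>, solve \<open>G (\<beta> F 1) = b\<close> and take \<open>y v + \<beta> F 1\<close>.\<close>

lemma plane_coords_image:
  assumes v: "v \<in> coord_space {0..r}" "v 0 \<noteq> 0"
  shows "plane_coords v ` coord_space {0..r} = UNIV"
proof -
  have "p \<in> plane_coords v ` coord_space {0..r}" for p
  proof -
    obtain y b where p: "p = (y, b)" by fastforce
    obtain \<beta> where \<beta>: "BEL_mult r f g 1 \<beta> = b"
      using surj_BEL_mult[of 1] by (metis surjD zero_neq_one)
    let ?a = "\<lambda>i. y * v i + \<beta> * tuple r f 1 i"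
    have "plane_coords v ?a = p"
      using v(2) \<beta> by (auto simp: p plane_coords_def BEL_mult_def tuple_def mult.commute)
    moreover have "?a \<in> coord_space {0..r}" using v(1) by (auto simp: coord_space_def tuple_def)
    ultimately show ?thesis by blast
  qed
  then show ?thesis by blast
qed

lemma plane_coords_kernel:
  assumes "v 0 \<noteq> 0"
  shows "{a \<in> coord_space {0..r}. plane_coords v a = 0} = W_space r g"
  unfolding W_space_def coord_space_hyperplane
  using assms by (auto simp: plane_coords_def zero_prod_def)

text \<open>The generators in \<open>W\<close> are killed, and the image of a line is already a subspace.\<close>

lemma plane_coords_span_line:
  assumes "v 0 \<noteq> 0"
  shows "plane_coords v ` vec.span (line z \<union> W_space r g) = plane_coords v ` line z"
proof -
  interpret Vector_Spaces.linear "scale_vec \<iota>" "scale_pair \<iota>" "plane_coords v"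
    by (rule linear_plane_coords)
  have sub: "vec.subspace (line z)"
    unfolding vec.subspace_def line_def
  proof (intro conjI ballI allI, goal_cases)
    case 1
    show ?case by (auto intro!: exI[of _ 0])
  next
    case (2 x y)
    then obtain \<alpha> \<beta> where "x = (\<lambda>i. \<alpha> * z i)" "y = (\<lambda>i. \<beta> * z i)" by blast
    then have "x + y = (\<lambda>i. (\<alpha> + \<beta>) * z i)" by (auto simp: distrib_right)
    then show ?case by blast
  next
    case (3 c x)
    then obtain \<alpha> where "x = (\<lambda>i. \<alpha> * z i)" by blast
    then have "scale_vec \<iota> c x = (\<lambda>i. (\<iota> c * \<alpha>) * z i)" by (auto simp: scale_vec_def mult.assoc)
    then show ?case by blast
  qed
  have ps: "pair.subspace (plane_coords v ` line z)" by (rule subspace_image[OF sub])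
  have "plane_coords v ` W_space r g \<subseteq> {0}" using plane_coords_kernel[of v] assms by blast
  then have "plane_coords v ` (line z \<union> W_space r g) = plane_coords v ` line z"
    using pair.subspace_0[OF ps] by auto
  then show ?thesis using ps by (simp add: span_image[symmetric] pair.span_eq_iff)
qed

text \<open>Dividing \<open>z = c v + F x\<close> by \<open>c \<noteq> 0\<close> replaces \<open>x\<close> by \<open>x / c\<close> and keeps the line, because
  \<open>c\<close> lies in the small field and \<open>F\<close> is linear over it.\<close>

lemma plane_coords_lines:
  assumes v: "v \<in> coord_space {0..r}" "v 0 \<noteq> 0"
  shows "{plane_coords v ` line z | z. z \<in> vec.span (insert v (U_space r f)) \<and> z \<noteq> 0}
    = presemifield_spread (BEL_mult r f g)"
proof -
  let ?m = "BEL_mult r f g"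
  have line: "plane_coords v ` line z = {(\<alpha> * c, ?m x \<alpha>) | \<alpha>. True}"
    if "z = (\<lambda>i. c * v i + tuple r f x i)" for z c x
  proof -
    have "plane_coords v ` line z = range (\<lambda>\<alpha>. plane_coords v (\<lambda>i. \<alpha> * z i))"
      unfolding line_def by blast
    also have "\<dots> = range (\<lambda>\<alpha>. (\<alpha> * c, ?m x \<alpha>))"
      using plane_coords_line[of v z c x] v(2) that by (simp add: tuple_def)
    finally show ?thesis by blast
  qed
  have graph: "{(\<alpha> * \<iota> c, ?m x \<alpha>) | \<alpha>. True} = {(y, ?m (\<iota> (inverse c) * x) y) | y. True}"
    if "c \<noteq> 0" for c x
  proof -
    have inv: "\<iota> c * \<iota> (inverse c) = 1" using hom that by (metis field_hom_def right_inverse)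
    then have c0: "\<iota> c \<noteq> 0" by auto
    have m: "?m (\<iota> (inverse c) * x) (\<alpha> * \<iota> c) = ?m x \<alpha>" for \<alpha>
    proof -
      have "f i (\<iota> (inverse c) * x) * (\<alpha> * \<iota> c) = f i x * \<alpha>" if "i \<in> {1..r}" for i
      proof -
        have "f i (\<iota> (inverse c) * x) * (\<alpha> * \<iota> c) = (\<iota> c * \<iota> (inverse c)) * (f i x * \<alpha>)"
          unfolding f_scale[OF that] by (simp only: mult_ac)
        then show ?thesis by (simp add: inv)
      qed
      then have "(\<Sum>i=1..r. g i (f i (\<iota> (inverse c) * x) * (\<alpha> * \<iota> c)))
          = (\<Sum>i=1..r. g i (f i x * \<alpha>))"
        by (intro sum.cong refl arg_cong[of _ _ "g _"])
      then show ?thesis by (simp add: BEL_mult_def)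
    qed
    have "surj (\<lambda>\<alpha>. \<alpha> * \<iota> c)" using c0 by (intro surjI[of _ "\<lambda>y. y / \<iota> c"]) simp
    then have "range (\<lambda>y. (y, ?m (\<iota> (inverse c) * x) y))
        = (\<lambda>y. (y, ?m (\<iota> (inverse c) * x) y)) ` range (\<lambda>\<alpha>. \<alpha> * \<iota> c)"
      by simp
    also have "\<dots> = range (\<lambda>\<alpha>. (\<alpha> * \<iota> c, ?m x \<alpha>))" by (simp add: image_image m)
    finally show ?thesis by blast
  qed
  have vertical: "{(\<alpha> * 0, ?m x \<alpha>) | \<alpha>. True} = {(0, y) | y. True}" if "x \<noteq> 0" for x
  proof -
    have "range (Pair 0 \<circ> ?m x) = range (Pair 0)"
      unfolding image_comp[symmetric] surj_BEL_mult[OF that] ..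
    then show ?thesis by (auto simp: full_SetCompr_eq o_def)
  qed
  have U: "vec.span (U_space r f) = U_space r f"
    using BEL by (simp add: BEL_configuration_def vec.span_eq_iff)
  have span: "z \<in> vec.span (insert v (U_space r f)) \<longleftrightarrow>
      (\<exists>c x. z = (\<lambda>i. \<iota> c * v i + tuple r f x i))" for z
  proof -
    have "z - scale_vec \<iota> c v = tuple r f x \<longleftrightarrow> z = (\<lambda>i. \<iota> c * v i + tuple r f x i)" for c x
      unfolding scale_vec_def fun_eq_iff by (auto simp: diff_eq_eq add.commute)
    then show ?thesis unfolding vec.span_insert U by (auto simp: U_space_eq image_iff)
  qed
  have \<iota>1: "\<iota> 1 = 1" using hom by (simp add: field_hom_def)
  show ?thesis
  proof (intro equalityI subsetI)
    fix S assume "S \<in> {plane_coords v ` line z | z. z \<in> vec.span (insert v (U_space r f)) \<and> z \<noteq> 0}"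
    then obtain z c x where S: "S = plane_coords v ` line z" and "z \<noteq> 0"
      and z: "z = (\<lambda>i. \<iota> c * v i + tuple r f x i)" by (auto simp only: span mem_Collect_eq)
    have S': "S = {(\<alpha> * \<iota> c, ?m x \<alpha>) | \<alpha>. True}" using S line[OF z] by simp
    show "S \<in> presemifield_spread ?m"
    proof (cases "c = 0")
      case True
      then have "z = tuple r f x" using z \<iota>_0 by simp
      then have "x \<noteq> 0" using \<open>z \<noteq> 0\<close> tuple_eq_0_iff by metis
      then have "S = {(0, y) | y. True}" using S' vertical True \<iota>_0 by simp
      then show ?thesis unfolding presemifield_spread_def by blast
    next
      case False
      then show ?thesis unfolding presemifield_spread_def S' graph[OF False] by blast
    qed
  next
    fix S assume "S \<in> presemifield_spread ?m"
    then consider x where "S = {(y, ?m x y) | y. True}" | "S = {(0, y) | y. True}"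
      unfolding presemifield_spread_def by blast
    then show "S \<in> {plane_coords v ` line z | z. z \<in> vec.span (insert v (U_space r f)) \<and> z \<noteq> 0}"
    proof cases
      case (1 x)
      let ?z = "\<lambda>i. \<iota> 1 * v i + tuple r f x i"
      have "?z 0 \<noteq> 0" using v(2) by (simp add: \<iota>1 tuple_def)
      then have "?z \<noteq> 0" by (metis zero_fun_apply)
      moreover have "plane_coords v ` line ?z = S" using line[of ?z "\<iota> 1" x] 1 by (simp add: \<iota>1)
      ultimately show ?thesis using span by blast
    next
      case 2
      let ?z = "\<lambda>i. \<iota> 0 * v i + tuple r f 1 i"
      have "?z \<noteq> 0" using tuple_eq_0_iff[of 1] by (simp add: \<iota>_0)
      moreover have "plane_coords v ` line ?z = S"
        using line[of ?z "\<iota> 0" 1] 2 vertical[of 1] by (simp add: \<iota>_0)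
      ultimately show ?thesis using span by blast
    qed
  qed
qed

lemma equivalent_spreads_BEL_mult:
  assumes v: "v \<in> coord_space {0..r}" "v 0 \<noteq> 0"
  shows "equivalent_spreads
      (quotient_vspace (scale_vec \<iota>) (coord_space {0..r}) (W_space r g))
      (BEL_spread \<iota> (U_space r f) (W_space r g) v)
      (plane_vspace \<iota>)
      (presemifield_spread (BEL_mult r f g))"
proof -
  let ?V = "coord_space {0..r} :: (nat \<Rightarrow> 'a) set" and ?W = "W_space r g"
  have V: "vec.subspace ?V" by (auto simp: vec.subspace_def coord_space_def scale_vec_def)
  have W: "vec.subspace ?W" using BEL by (simp add: BEL_configuration_def)
  obtain \<phi> where
    bij: "semilinear_bijection (quotient_vspace (scale_vec \<iota>) ?V ?W)
      \<lparr>vcarrier = UNIV, vadd = (+), vscale = scale_pair \<iota>\<rparr> \<phi>"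
    and \<phi>: "\<And>a. \<phi> (coset ?W a) = plane_coords v a"
    by (rule semilinear_bijection_quotient[OF linear_plane_coords V W plane_coords_kernel[of v, OF v(2)]
          plane_coords_image[of v, OF v]]) (rule that)
  have \<phi>_quotient: "\<phi> ` quotient_set A ?W = plane_coords v ` A" for A
    by (simp add: quotient_set_def image_image \<phi>)
  have "(\<lambda>S. \<phi> ` S) ` BEL_spread \<iota> (U_space r f) ?W v
      = {\<phi> ` quotient_set (vec.span (line z \<union> ?W)) ?W | z.
          z \<in> vec.span (insert v (U_space r f)) \<and> z \<noteq> 0}"
    unfolding BEL_spread_def by blast
  also have "\<dots> = presemifield_spread (BEL_mult r f g)"
    using plane_coords_lines[OF v] by (simp add: \<phi>_quotient plane_coords_span_line v(2))
  finally show ?thesis using bij unfolding equivalent_spreads_def plane_vspace_def by blast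
qed

end

theorem theorem3:
  fixes \<iota> :: "'k::{field,finite} \<Rightarrow> 'a::{field,finite}"
    and q n r :: nat
    and f g :: "nat \<Rightarrow> 'a \<Rightarrow> 'a"
    and v :: "nat \<Rightarrow> 'a"
  assumes "field_hom \<iota>"
    and "CARD('k) = q" and "CARD('a) = q ^ n"
    and "n \<ge> 1" and "r \<ge> 1"
    and "\<And>i. i \<in> {1..r} \<Longrightarrow> Vector_Spaces.linear (scale \<iota>) (scale \<iota>) (f i)"
    and "\<And>i. i \<in> {1..r} \<Longrightarrow> Vector_Spaces.linear (scale \<iota>) (scale \<iota>) (g i)"
    and "BEL_configuration \<iota> r n (U_space r f) (W_space r g)"
    and "v \<in> coord_space {0..r} - coord_space {1..r}"
  shows "presemifield (BEL_mult r f g) \<and>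
    equivalent_spreads
      (quotient_vspace (scale_vec \<iota>) (coord_space {0..r}) (W_space r g))
      (BEL_spread \<iota> (U_space r f) (W_space r g) v)
      (plane_vspace \<iota>)
      (presemifield_spread (BEL_mult r f g))"
proof -
  interpret BEL_data \<iota> n r f g
    by (rule BEL_data.intro) (use assms in blast | simp add: assms)+
  have "v \<in> coord_space {0..r}" "v 0 \<noteq> 0"
    using assms(9) unfolding coord_space_hyperplane by blast+
  then show ?thesis
    using presemifield_BEL_mult equivalent_spreads_BEL_mult by blast
qed

end
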